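(* Let $D$ be a numerical dataset over attributes $A_1,\ldots,A_m$, let $\mathcal{F}=\{F_1,F_2,\ldots,F_K\}$ be the set of linear projections returned by the projection-generating procedure (described in the context) on input $D$, and let $\sigma^*=\min_{k}\sigma(F_k(D))$. If $\mu(A_k(D))=0$ for every attribute $A_k$, then: (1) $\sigma^*\le\sigma(F(D))$ for every $F=\vec A^T\vec w$ with $\|\vec w\|\ge 1$; and (2) for all $F_j,F_k\in\mathcal{F}$ with $F_j\ne F_k$, $\rho_{F_j,F_k}=0$.
   Context: $D$ consists of $|D|$ tuples in $\mathbb{R}^m$ and is also viewed as a real matrix with $|D|$ rows (the tuples) and $m$ columns (the attributes). $A_k(D)$ is the sequence of values of attribute $A_k$ over $D$ and $\mu(A_k(D))$ is its mean. A linear projection is a function $F(\vec A)=\vec A^T\vec w$ on tuples $\vec A\in\mathbb{R}^m$, with coefficient vector $\vec w\in\mathbb{R}^m$; $\|\cdot\|$ is the 2-norm. $F(D)$ is the sequence of values $F(t)$, $t\in D$; $\mu(F(D))$ and $\sigma(F(D))$ are its mean and standard deviation. The correlation coefficient over $D$ is $$\rho_{F,G}=\frac{\frac1{|D|}\sum_{t\in D}(F(t)-\mu(F(D)))(G(t)-\mu(G(D)))}{\sigma(F(D))\,\sigma(G(D))}.$$ Projection-generating procedure (for a numerical dataset): form the matrix $D'=[\vec 1;D]$ obtained by adding to $D$ a first column all of whose entries are $1$, and let $K$ be the number of columns of $D'$. Compute the $K$ (mutually orthogonal) eigenvectors $\vec w_1,\ldots,\vec w_K$ of ${D'}^TD'$.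 For each $k$, let $\vec w_k'$ be $\vec w_k$ with its first element removed, and set $F_k(\vec A)=\vec A^T\vec w_k'/\|\vec w_k'\|$. Return $F_1,\ldots,F_K$. (The procedure also returns an importance factor for each $F_k$, which plays no role here.)
   Formalization: Indices with w_k' = 0, for which F_k is undefined, are omitted. Part (2) is proved only if |D| is not an eigenvalue of D^T D or some w_k is a multiple of (1,0,…,0); otherwise it can fail: for D = {1,−1}, eigenvectors (1,1), (1,−1) give A and −A with correlation −1. *)

theory Defs
  imports "HOL-Analysis.Analysis"
begin

text \<open>A dataset is a matrix \<open>D :: real ^ 'm ^ 'n\<close>: row \<open>D $ i\<close> is the \<open>i\<close>-th tuple, so
  repeated tuples are allowed, and there are \<open>CARD('n)\<close> tuples and \<open>CARD('m)\<close> attributes.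
  Sequences of values over a dataset are functions on the row index type.\<close>

definition mean :: "('n::finite \<Rightarrow> real) \<Rightarrow> real" where
  "mean x = (\<Sum>i\<in>UNIV. x i) / real CARD('n)"

text \<open>The standard deviation is normalised by the number of values, to match the covariance
  in the correlation coefficient.\<close>

definition std_dev :: "('n::finite \<Rightarrow> real) \<Rightarrow> real" where
  "std_dev x = sqrt ((\<Sum>i\<in>UNIV. (x i - mean x)\<^sup>2) / real CARD('n))"

definition attribute_values :: "'m \<Rightarrow> real ^ 'm ^ 'n \<Rightarrow> 'n \<Rightarrow> real" where
  "attribute_values k D = (\<lambda>i. D $ i $ k)"

definition linear_projection :: "real ^ 'm \<Rightarrow> real ^ 'm \<Rightarrow> real" where
  "linear_projection w = (\<lambda>A. A \<bullet> w)"

definition values_on :: "(real ^ 'm \<Rightarrow> real) \<Rightarrow> real ^ 'm ^ 'n \<Rightarrow> 'n \<Rightarrow> real" where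
  "values_on F D = (\<lambda>i. F (D $ i))"

text \<open>When one of the standard deviations vanishes, the numerator is \<open>0\<close> as well and the
  quotient is \<open>0\<close> by the convention for division by zero.\<close>

definition correlation ::
  "real ^ 'm ^ 'n \<Rightarrow> (real ^ 'm \<Rightarrow> real) \<Rightarrow> (real ^ 'm \<Rightarrow> real) \<Rightarrow> real" where
  "correlation D F G =
     (1 / real CARD('n) *
       (\<Sum>i\<in>UNIV. (F (D $ i) - mean (values_on F D)) * (G (D $ i) - mean (values_on G D))))
     / (std_dev (values_on F D) * std_dev (values_on G D))"

definition is_eigenvector :: "real ^ 'k ^ 'k \<Rightarrow> real \<Rightarrow> real ^ 'k \<Rightarrow> bool" where
  "is_eigenvector M c v \<longleftrightarrow> v \<noteq> 0 \<and> M *v v = c *\<^sub>R v"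

text \<open>The columns of the augmented matrix are indexed by \<open>'m option\<close>, where \<open>None\<close> is the
  index of the added first column.\<close>

definition augmented :: "real ^ 'm ^ 'n \<Rightarrow> real ^ ('m option) ^ 'n" where
  "augmented D = (\<chi> i j. case j of None \<Rightarrow> 1 | Some k \<Rightarrow> D $ i $ k)"

definition drop_first :: "real ^ ('m option) \<Rightarrow> real ^ 'm" where
  "drop_first v = (\<chi> k. v $ Some k)"

text \<open>A full system \<open>w 1, \<dots>, w K\<close> of mutually orthogonal eigenvectors of the Gram matrix of the
  augmented data, where \<open>K\<close> is its number of columns. Such a system is not unique, and no
  normalisation is imposed on the vectors.\<close>

definition eigenvector_system :: "real ^ 'm ^ 'n \<Rightarrow> (nat \<Rightarrow> real ^ ('m option)) \<Rightarrow> bool" where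
  "eigenvector_system D w \<longleftrightarrow>
     (\<forall>k\<in>{1..CARD('m option)}.
        \<exists>c. is_eigenvector (transpose (augmented D) ** augmented D) c (w k)) \<and>
     (\<forall>j\<in>{1..CARD('m option)}. \<forall>k\<in>{1..CARD('m option)}. j \<noteq> k \<longrightarrow> orthogonal (w j) (w k))"

text \<open>A vector whose entries other than the first all vanish yields no projection, since
  normalising it would divide by zero. Such an index must be left out: reading \<open>0 / 0\<close> as \<open>0\<close>
  would produce the zero projection, which has standard deviation \<open>0\<close>.\<close>

definition returned_projections ::
  "(nat \<Rightarrow> real ^ ('m option)) \<Rightarrow> (real ^ 'm \<Rightarrow> real) set" where
  "returned_projections w =
     {linear_projection ((1 / norm (drop_first (w k))) *\<^sub>R drop_first (w k)) | k.
        k \<in> {1..CARD('m option)} \<and> drop_first (w k) \<noteq> 0}"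

definition min_std_dev :: "real ^ 'm ^ 'n \<Rightarrow> (real ^ 'm \<Rightarrow> real) set \<Rightarrow> real" where
  "min_std_dev D \<F> = Min ((\<lambda>F. std_dev (values_on F D)) ` \<F>)"

text \<open>For centred data the first coordinate vector is itself an eigenvector of the Gram matrix of
  the augmented data, with eigenvalue the number of tuples. The condition below says that this
  eigenvalue is simple, or that a multiple of the first coordinate vector was chosen anyway. (For
  centred data the first disjunct implies the second.) Otherwise the constant column gets mixed
  into several eigenvectors, and the resulting projections can be correlated: for the dataset with
  the two tuples \<open>1\<close> and \<open>-1\<close>, the system \<open>(1, 1)\<close>, \<open>(1, -1)\<close> yields \<open>A\<close> and \<open>-A\<close>, whose
  correlation is \<open>-1\<close>.\<close>

definition constant_direction_separated ::
  "real ^ 'm ^ 'n \<Rightarrow> (nat \<Rightarrow> real ^ ('m option)) \<Rightarrow> bool" where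
  "constant_direction_separated D w \<longleftrightarrow>
     (\<nexists>v. is_eigenvector (transpose D ** D) (real CARD('n)) v) \<or>
     (\<exists>k\<in>{1..CARD('m option)}. drop_first (w k) = 0)"

end

theory Submission
  imports Defs
begin

text \<open>For centred data the constant column is orthogonal to the attribute columns, so the Gram matrix
  of the augmented data is block diagonal with blocks \<open>N\<close> (the number of tuples) and
  \<open>transpose D ** D\<close>. Hence the tail \<open>u\<close> of an eigenvector satisfies \<open>D u \<bullet> D v = c (u \<bullet> v)\<close>
  for all \<open>v\<close>, the projection along \<open>u\<close> has variance \<open>c / N\<close>, and orthogonal tails give
  uncorrelated projections. Claim (1) follows by expanding \<open>(0, v)\<close> in the orthogonal eigenvectors;
  in claim (2) the separation condition forces the first entries of all eigenvectors with non-zero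
  tail to vanish, so that the tails inherit orthogonality.\<close>

section \<open>Splitting off the coordinate of the constant column\<close>

text \<open>A right inverse of \<open>drop_first\<close>; its values serve as test vectors that see
  only the attribute block of the Gram matrix.\<close>

definition prepend_zero :: "real ^ 'm \<Rightarrow> real ^ ('m option)" where
  "prepend_zero v = (\<chi> j. case j of None \<Rightarrow> 0 | Some k \<Rightarrow> v $ k)"

lemma prepend_zero_nth [simp]: "prepend_zero v $ None = 0"
  by (simp add: prepend_zero_def)

lemma drop_first_prepend_zero [simp]: "drop_first (prepend_zero v) = v"
  by (simp add: prepend_zero_def drop_first_def vec_eq_iff)

lemma drop_first_axis_None [simp]: "drop_first (axis None 1) = 0"
  by (simp add: axis_def drop_first_def vec_eq_iff)

lemma inner_option:
  fixes x y :: "real ^ ('m::finite option)"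
  shows "x \<bullet> y = x $ None * y $ None + drop_first x \<bullet> drop_first y"
  by (simp add: inner_vec_def drop_first_def UNIV_option_conv sum.reindex)

lemma augmented_mult_nth:
  fixes D :: "real ^ 'm ^ 'n"
  shows "(augmented D *v x) $ i = x $ None + (D *v drop_first x) $ i"
  by (simp add: matrix_vector_mult_def augmented_def drop_first_def UNIV_option_conv sum.reindex)

lemma augmented_mult_prepend_zero:
  "augmented D *v prepend_zero v = D *v v"
  by (simp add: vec_eq_iff augmented_mult_nth)

lemma gram_inner:
  fixes A :: "real ^ 'm ^ 'n"
  shows "((transpose A ** A) *v x) \<bullet> y = (A *v x) \<bullet> (A *v y)"
  by (metis dot_lmul_matrix matrix_vector_mul_assoc transpose_matrix_vector)

text \<open>The weak form of the eigenvector equation; choosing \<open>y\<close> extracts one block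
  at a time.\<close>

lemma eigenvector_inner:
  assumes "is_eigenvector (transpose A ** A) c x"
  shows "(A *v x) \<bullet> (A *v y) = c * (x \<bullet> y)"
  using assms by (simp add: is_eigenvector_def flip: gram_inner)

section \<open>Statistics of projections of centred data\<close>

lemma centred_sum_mult:
  fixes D :: "real ^ 'm ^ 'n"
  assumes "\<forall>k. mean (attribute_values k D) = 0"
  shows "(\<Sum>i\<in>UNIV. (D *v v) $ i) = 0"
proof -
  have "(\<Sum>i\<in>UNIV. D $ i $ k) = 0" for k
    using assms by (simp add: mean_def attribute_values_def)
  then have "(\<Sum>k\<in>UNIV. (\<Sum>i\<in>UNIV. D $ i $ k) * v $ k) = 0"
    by simp
  then show ?thesis
    unfolding matrix_vector_mult_def
    by (simp add: sum_distrib_right sum.swap[of _ "UNIV :: 'm set"])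
qed

lemma values_on_linear_projection:
  "values_on (linear_projection v) D = (\<lambda>i. (D *v v) $ i)"
  by (simp add: values_on_def linear_projection_def matrix_vector_mult_def inner_vec_def)

lemma mean_linear_projection:
  fixes D :: "real ^ 'm ^ 'n"
  assumes "\<forall>k. mean (attribute_values k D) = 0"
  shows "mean (values_on (linear_projection v) D) = 0"
  using centred_sum_mult[OF assms]
  by (simp add: values_on_linear_projection) (simp add: mean_def)

lemma std_dev_linear_projection:
  fixes D :: "real ^ 'm ^ 'n"
  assumes "\<forall>k. mean (attribute_values k D) = 0"
  shows "std_dev (values_on (linear_projection v) D)
    = sqrt ((D *v v) \<bullet> (D *v v) / real CARD('n))"
  unfolding std_dev_def mean_linear_projection[OF assms]
  by (simp add: values_on_linear_projection inner_vec_def power2_eq_square)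

lemma correlation_linear_projection_eq_0:
  fixes D :: "real ^ 'm ^ 'n"
  assumes "\<forall>k. mean (attribute_values k D) = 0" and "(D *v u) \<bullet> (D *v v) = 0"
  shows "correlation D (linear_projection u) (linear_projection v) = 0"
proof -
  have "linear_projection a (D $ i) = (D *v a) $ i" for a i
    using values_on_linear_projection[of a D] by (metis values_on_def)
  then show ?thesis
    using assms(2) unfolding correlation_def mean_linear_projection[OF assms(1)]
    by (simp add: inner_vec_def)
qed

section \<open>Block structure of the augmented Gram matrix\<close>

lemma augmented_inner:
  fixes D :: "real ^ 'm ^ 'n"
  assumes "\<forall>k. mean (attribute_values k D) = 0"
  shows "(augmented D *v x) \<bullet> (augmented D *v y)
    = real CARD('n) * (x $ None * y $ None) + (D *v drop_first x) \<bullet> (D *v drop_first y)"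
proof -
  have "(augmented D *v x) \<bullet> (augmented D *v y)
    = (\<Sum>i\<in>UNIV. x $ None * y $ None + x $ None * (D *v drop_first y) $ i
        + y $ None * (D *v drop_first x) $ i
        + (D *v drop_first x) $ i * (D *v drop_first y) $ i)"
    by (simp add: inner_vec_def augmented_mult_nth algebra_simps)
  also have "\<dots> = real CARD('n) * (x $ None * y $ None)
      + (\<Sum>i\<in>UNIV. (D *v drop_first x) $ i * (D *v drop_first y) $ i)"
    by (simp add: sum.distrib centred_sum_mult[OF assms] flip: sum_distrib_left)
  finally show ?thesis
    by (simp add: inner_vec_def)
qed

text \<open>Testing against \<open>prepend_zero v\<close> removes the first entries from both
  sides.\<close>

lemma augmented_eigenvector_tail:
  fixes D :: "real ^ 'm ^ 'n"
  assumes "\<forall>k. mean (attribute_values k D) = 0"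
    and "is_eigenvector (transpose (augmented D) ** augmented D) c x"
  shows "(D *v drop_first x) \<bullet> (D *v v) = c * (drop_first x \<bullet> v)"
  using eigenvector_inner[OF assms(2), of "prepend_zero v"]
  by (simp add: augmented_inner[OF assms(1)] inner_option)

text \<open>Testing against \<open>axis None 1\<close> removes the tails instead, and the non-zero
  first entry cancels.\<close>

lemma augmented_eigenvector_head:
  fixes D :: "real ^ 'm ^ 'n"
  assumes "\<forall>k. mean (attribute_values k D) = 0"
    and "is_eigenvector (transpose (augmented D) ** augmented D) c x"
    and "x $ None \<noteq> 0"
  shows "c = real CARD('n)"
  using eigenvector_inner[OF assms(2), of "axis None 1"] assms(3)
  by (simp add: augmented_inner[OF assms(1)] inner_option)

lemma eigenvectorI:
  fixes D :: "real ^ 'm ^ 'n"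
  assumes "u \<noteq> 0" and "\<And>v. (D *v u) \<bullet> (D *v v) = c * (u \<bullet> v)"
  shows "is_eigenvector (transpose D ** D) c u"
proof -
  have "((transpose D ** D) *v u) \<bullet> v = (c *\<^sub>R u) \<bullet> v" for v
    by (simp add: assms(2) gram_inner)
  then show ?thesis
    using assms(1) unfolding is_eigenvector_def by (metis vector_eq_ldot inner_commute)
qed

section \<open>Orthogonal expansion and the minimal standard deviation\<close>

text \<open>Non-zero orthogonal vectors are independent, so by their number they span the space. The
  residual \<open>y\<close> is orthogonal to all of them, hence to itself.\<close>

lemma orthogonal_expansion:
  fixes w :: "'i \<Rightarrow> 'a::euclidean_space"
  assumes "finite I" "card I = DIM('a)" "\<And>k. k \<in> I \<Longrightarrow> w k \<noteq> 0"
    and orth: "\<And>j k. j \<in> I \<Longrightarrow> k \<in> I \<Longrightarrow> j \<noteq> k \<Longrightarrow> orthogonal (w j) (w k)"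
  shows "x = (\<Sum>k\<in>I. ((w k \<bullet> x) / (w k \<bullet> w k)) *\<^sub>R w k)"
proof -
  define y where "y = x - (\<Sum>k\<in>I. ((w k \<bullet> x) / (w k \<bullet> w k)) *\<^sub>R w k)"
  have inj: "inj_on w I"
    using assms(3) orth by (metis inj_onI orthogonal_self)
  have "independent (w ` I)"
  proof (rule pairwise_orthogonal_independent)
    show "pairwise orthogonal (w ` I)"
      using orth by (auto simp: pairwise_def)
  qed (use assms(3) in auto)
  then have "UNIV \<subseteq> span (w ` I)"
    by (intro card_ge_dim_independent) (use inj assms(2) in \<open>auto simp: card_image\<close>)
  moreover have "orthogonal y z" if z: "z \<in> w ` I" for z
  proof -
    obtain j where j: "j \<in> I" "z = w j"
      using z by blast
    have "(\<Sum>k\<in>I. ((w k \<bullet> x) / (w k \<bullet> w k)) * (w k \<bullet> w j))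
      = (\<Sum>k\<in>I. if k = j then w j \<bullet> x else 0)"
      using j assms(3) orth by (intro sum.cong) (auto simp: orthogonal_def)
    also have "\<dots> = w j \<bullet> x"
      using j assms(1) by simp
    finally show ?thesis
      by (simp add: j(2) y_def orthogonal_def inner_diff_left inner_sum_left inner_commute[of x])
  qed
  ultimately have "orthogonal y y"
    by (meson UNIV_I orthogonal_to_span subset_iff)
  then show ?thesis
    by (simp add: y_def orthogonal_self)
qed

text \<open>A Rayleigh quotient bound: every eigenvalue with positive weight in the expansion of
  \<open>x\<close> is at least \<open>N * s\<^sup>2\<close>.\<close>

lemma min_std_dev_le:
  fixes D :: "real ^ 'm ^ 'n" and v :: "real ^ 'm"
  assumes sys: "eigenvector_system D w"
    and centred: "\<forall>k. mean (attribute_values k D) = 0"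
    and v: "norm v \<ge> 1"
  shows "min_std_dev D (returned_projections w) \<le> std_dev (values_on (linear_projection v) D)"
proof -
  define I where "I = {1..CARD('m option)}"
  define N where "N = real CARD('n)"
  define s where "s = min_std_dev D (returned_projections w)"
  define p where
    "p k = linear_projection ((1 / norm (drop_first (w k))) *\<^sub>R drop_first (w k))" for k
  define x where "x = prepend_zero v"
  have "N > 0"
    by (simp add: N_def)
  obtain c where c: "is_eigenvector (transpose (augmented D) ** augmented D) (c k) (w k)"
    if "k \<in> I" for k
    using sys unfolding eigenvector_system_def I_def by metis
  have w0: "w k \<noteq> 0" if "k \<in> I" for k
    using c[OF that] by (simp add: is_eigenvector_def)
  have "x = (\<Sum>k\<in>I. ((w k \<bullet> x) / (w k \<bullet> w k)) *\<^sub>R w k)"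
    using sys w0 by (intro orthogonal_expansion) (auto simp: I_def eigenvector_system_def)
  then have expand: "x \<bullet> z = (\<Sum>k\<in>I. ((w k \<bullet> x) / (w k \<bullet> w k)) * (w k \<bullet> z))" for z
    by (metis (no_types, lifting) inner_scaleR_left inner_sum_left sum.cong)
  have wx: "w k \<bullet> x = drop_first (w k) \<bullet> v" for k
    by (simp add: x_def inner_option)
  have xx: "x \<bullet> x = v \<bullet> v"
    by (simp add: x_def inner_option)
  have variance: "std_dev (values_on (p k) D) = sqrt (c k / N)"
    if "k \<in> I" "drop_first (w k) \<noteq> 0" for k
  proof -
    let ?u = "drop_first (w k)"
    have "(D *v ?u) \<bullet> (D *v ?u) / (norm ?u)\<^sup>2 = c k"
      using that(2) augmented_eigenvector_tail[OF centred c[OF that(1)], of ?u]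
      by (simp add: power2_norm_eq_inner)
    then show ?thesis
      by (simp add: p_def N_def std_dev_linear_projection[OF centred] matrix_vector_mult_scaleR
          power2_eq_square)
  qed
  have proj: "returned_projections w = p ` {k \<in> I. drop_first (w k) \<noteq> 0}"
    by (auto simp: returned_projections_def p_def I_def)
  have fin: "finite (returned_projections w)"
    by (simp add: proj I_def)
  have s_le: "s \<le> sqrt (c k / N)" if "k \<in> I" "drop_first (w k) \<noteq> 0" for k
    unfolding s_def min_std_dev_def variance[OF that, symmetric]
    by (rule Min_le) (use fin that in \<open>auto simp: proj\<close>)
  \<comment> \<open>If all tails vanished, so would all coefficients of \<open>x\<close>. Hence the
    minimum ranges over a non-empty set and is attained.\<close>
  have "x \<bullet> x \<noteq> 0"
    using v by (auto simp: xx)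
  then obtain l where "l \<in> I" "drop_first (w l) \<noteq> 0"
    by (metis (no_types, lifting) expand inner_zero_left mult_zero_right sum.neutral wx)
  then have "s \<in> (\<lambda>F. std_dev (values_on F D)) ` returned_projections w"
    unfolding s_def min_std_dev_def using fin by (intro Min_in) (auto simp: proj)
  then have "s \<ge> 0"
    by (auto simp: std_dev_def intro!: divide_nonneg_nonneg sum_nonneg)
  \<comment> \<open>\<open>s \<ge> 0\<close> permits squaring and, through \<open>s_le\<close>,
    shows that the radicand is non-negative.\<close>
  have s2: "N * s\<^sup>2 \<le> c k" if "k \<in> I" "drop_first (w k) \<noteq> 0" for k
  proof -
    have "s\<^sup>2 \<le> c k / N"
      using s_le[OF that] \<open>s \<ge> 0\<close> by (metis real_sqrt_ge_0_iff order_trans power_mono real_sqrt_pow2)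
    then show ?thesis
      using \<open>N > 0\<close> by (simp add: field_simps)
  qed
  have "N * s\<^sup>2 \<le> N * s\<^sup>2 * (v \<bullet> v)"
    using v \<open>N > 0\<close> mult_left_mono[of 1 "v \<bullet> v" "N * s\<^sup>2"]
    by (simp add: one_le_power flip: power2_norm_eq_inner)
  also have "\<dots> = (\<Sum>k\<in>I. N * s\<^sup>2 * ((w k \<bullet> x)\<^sup>2 / (w k \<bullet> w k)))"
    unfolding xx[symmetric] expand[of x] by (simp add: sum_distrib_left power2_eq_square)
  also have "\<dots> \<le> (\<Sum>k\<in>I. c k * ((w k \<bullet> x)\<^sup>2 / (w k \<bullet> w k)))"
  proof (rule sum_mono)
    fix k assume "k \<in> I"
    show "N * s\<^sup>2 * ((w k \<bullet> x)\<^sup>2 / (w k \<bullet> w k)) \<le> c k * ((w k \<bullet> x)\<^sup>2 / (w k \<bullet> w k))"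
    \<comment> \<open>With a zero tail \<open>s2\<close> says nothing, but then the coefficient
      \<open>w k \<bullet> x\<close> is zero.\<close>
    proof (cases "drop_first (w k) = 0")
      case False
      then show ?thesis
        by (intro mult_right_mono s2 \<open>k \<in> I\<close>) simp_all
    qed (simp add: wx)
  qed
  \<comment> \<open>By symmetry of the Gram matrix each eigenvalue is absorbed into the image of
    \<open>x\<close>, after which \<open>expand\<close> collapses the sum.\<close>
  also have "\<dots> = (\<Sum>k\<in>I. ((w k \<bullet> x) / (w k \<bullet> w k)) *
      (w k \<bullet> ((transpose (augmented D) ** augmented D) *v x)))"
  proof (intro sum.cong refl)
    fix k assume "k \<in> I"
    have "w k \<bullet> ((transpose (augmented D) ** augmented D) *v x) = c k * (w k \<bullet> x)"
      using eigenvector_inner[OF c[OF \<open>k \<in> I\<close>]] by (metis gram_inner inner_commute)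
    then show "c k * ((w k \<bullet> x)\<^sup>2 / (w k \<bullet> w k)) = ((w k \<bullet> x) / (w k \<bullet> w k)) *
      (w k \<bullet> ((transpose (augmented D) ** augmented D) *v x))"
      by (simp add: power2_eq_square)
  qed
  also have "\<dots> = x \<bullet> ((transpose (augmented D) ** augmented D) *v x)"
    by (rule expand[symmetric])
  also have "\<dots> = (D *v v) \<bullet> (D *v v)"
    by (metis augmented_mult_prepend_zero gram_inner inner_commute x_def)
  finally have "s\<^sup>2 \<le> (D *v v) \<bullet> (D *v v) / N"
    using \<open>N > 0\<close> by (simp add: field_simps)
  then show ?thesis
    unfolding std_dev_linear_projection[OF centred] by (simp add: real_le_rsqrt flip: s_def N_def)
qed

section \<open>Uncorrelated projections\<close>

text \<open>A non-zero first entry would make the tail an eigenvector for the number of tuples,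
  refuting the first disjunct of \<open>sep\<close>. The second supplies a non-zero multiple
  \<open>w l\<close> of the first coordinate vector, to which \<open>w k\<close> cannot be
  orthogonal.\<close>

lemma separated_head_eq_0:
  fixes D :: "real ^ 'm ^ 'n"
  assumes sys: "eigenvector_system D w"
    and centred: "\<forall>k. mean (attribute_values k D) = 0"
    and sep: "constant_direction_separated D w"
    and k: "k \<in> {1..CARD('m option)}" "drop_first (w k) \<noteq> 0"
  shows "w k $ None = 0"
proof (rule ccontr)
  assume nz: "w k $ None \<noteq> 0"
  obtain c where c: "is_eigenvector (transpose (augmented D) ** augmented D) c (w k)"
    using sys k(1) unfolding eigenvector_system_def by blast
  have "is_eigenvector (transpose D ** D) (real CARD('n)) (drop_first (w k))"
    using augmented_eigenvector_tail[OF centred c] augmented_eigenvector_head[OF centred c nz]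
    by (intro eigenvectorI k(2)) auto
  then obtain l where l: "l \<in> {1..CARD('m option)}" "drop_first (w l) = 0"
    using sep unfolding constant_direction_separated_def by blast
  \<comment> \<open>The indices differ because exactly one of the two tails is zero.\<close>
  then have "w l \<noteq> 0" "w k \<bullet> w l = 0"
    using sys k unfolding eigenvector_system_def is_eigenvector_def orthogonal_def by metis+
  then have "w l \<bullet> w l \<noteq> 0" "w k $ None * w l $ None = 0"
    using l(2) by (simp, simp add: inner_option)
  then show False
    using nz l(2) by (simp add: inner_option[of "w l"] del: inner_eq_zero_iff)
qed

lemma correlation_returned_projections:
  fixes D :: "real ^ 'm ^ 'n"
  assumes sys: "eigenvector_system D w"
    and centred: "\<forall>k. mean (attribute_values k D) = 0"
    and sep: "constant_direction_separated D w"
    and F: "F \<in> returned_projections w" and G: "G \<in> returned_projections w" and "F \<noteq> G"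
  shows "correlation D F G = 0"
proof -
  let ?u = "\<lambda>k. drop_first (w k)"
  obtain j where j: "j \<in> {1..CARD('m option)}" "?u j \<noteq> 0"
      "F = linear_projection ((1 / norm (?u j)) *\<^sub>R ?u j)"
    using F by (auto simp: returned_projections_def)
  obtain k where k: "k \<in> {1..CARD('m option)}" "?u k \<noteq> 0"
      "G = linear_projection ((1 / norm (?u k)) *\<^sub>R ?u k)"
    using G by (auto simp: returned_projections_def)
  have "j \<noteq> k"
    using j k \<open>F \<noteq> G\<close> by auto
  then have "w j \<bullet> w k = 0"
    using sys j k by (simp add: eigenvector_system_def orthogonal_def)
  then have "?u j \<bullet> ?u k = 0"
    using separated_head_eq_0[OF sys centred sep j(1,2)] by (simp add: inner_option)
  moreover obtain c where "is_eigenvector (transpose (augmented D) ** augmented D) c (w j)"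
    using sys j(1) unfolding eigenvector_system_def by blast
  ultimately have "(D *v ?u j) \<bullet> (D *v ?u k) = 0"
    using augmented_eigenvector_tail[OF centred] by (metis mult_zero_right)
  then show ?thesis
    unfolding j(3) k(3)
    by (intro correlation_linear_projection_eq_0[OF centred]) (simp add: matrix_vector_mult_scaleR)
qed

theorem theorem13:
  fixes D :: "real ^ 'm ^ 'n"
    and w :: "nat \<Rightarrow> real ^ ('m option)"
    and \<F> :: "(real ^ 'm \<Rightarrow> real) set"
  assumes "eigenvector_system D w"
    and "\<F> = returned_projections w"
    and "\<forall>k. mean (attribute_values k D) = 0"
  shows "(\<forall>v. norm v \<ge> 1 \<longrightarrow>
            min_std_dev D \<F> \<le> std_dev (values_on (linear_projection v) D)) \<and>
         (constant_direction_separated D w \<longrightarrow>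
            (\<forall>F\<in>\<F>. \<forall>G\<in>\<F>. F \<noteq> G \<longrightarrow> correlation D F G = 0))"
  unfolding assms(2)
  using min_std_dev_le[OF assms(1,3)] correlation_returned_projections[OF assms(1,3)] by blast

end
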